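(* Let $T$ be a finite tree whose center consists of a single vertex. A set $S\subseteq V(T)$ is a determining set for $T$ if and only if for every vertex $v$ of $T$ and every isomorphism class of branches at $v$, the set $S$ contains a vertex different from $v$ from each of the branches in that class except (at most) one; that is, all but one of the branches in each isomorphism class of branches at $v$ contain a vertex of $S\setminus\{v\}$.
   Context: A set $S\subseteq V(G)$ of a graph $G$ is a determining set if whenever $g,h\in\mathrm{Aut}(G)$ satisfy $g(s)=h(s)$ for all $s\in S$, then $g=h$. For a vertex $v$ of a tree $T$, a branch at $v$ is the subgraph induced by $v$ together with the vertices of one connected component of $T-v$ (so a branch is a maximal subtree containing $v$ as a leaf). Two branches $H,K$ at $v$ are isomorphic if there is a graph isomorphism $H\to K$ mapping $v$ to $v$; this partitions the branches at $v$ into isomorphism classes. The center of a tree is the set of vertices of minimum eccentricity. *)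

theory Defs
  imports "Graph_Theory.Graph_Theory" "HOL-Combinatorics.Permutations"
begin

text \<open>
  Finite simple undirected graphs are the symmetric digraphs of the locale \<open>graph\<close>. In such a
  digraph every edge yields a closed walk \<open>a, b, a\<close> that counts as a \<open>cycle\<close>, so the predicate
  \<open>tree\<close> for digraphs does not describe undirected trees. The cycles of the undirected graph are
  exactly the cycles of length at least three.
\<close>

definition undirected_tree :: "('a, 'b) pre_digraph \<Rightarrow> bool" where
  "undirected_tree G \<longleftrightarrow> graph G \<and> Digraph_Component.connected G \<and>
     \<not> (\<exists>p. pre_digraph.cycle G p \<and> 3 \<le> length p)"

definition graph_distance :: "('a, 'b) pre_digraph \<Rightarrow> 'a \<Rightarrow> 'a \<Rightarrow> ereal" where
  "graph_distance G = wf_digraph.\<mu> G (\<lambda>_. 1)"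

definition eccentricity :: "('a, 'b) pre_digraph \<Rightarrow> 'a \<Rightarrow> ereal" where
  "eccentricity G u = (SUP v\<in>verts G. graph_distance G u v)"

definition center :: "('a, 'b) pre_digraph \<Rightarrow> 'a set" where
  "center G = {u \<in> verts G. \<forall>v\<in>verts G. eccentricity G u \<le> eccentricity G v}"

text \<open>
  Isomorphisms of simple graphs are maps on vertices; the map on arcs carried by
  \<open>digraph_isomorphism\<close> is determined by the vertex map when there are no parallel arcs.
\<close>

definition graph_isomorphism ::
    "('a \<Rightarrow> 'c) \<Rightarrow> ('a, 'b) pre_digraph \<Rightarrow> ('c, 'd) pre_digraph \<Rightarrow> bool" where
  "graph_isomorphism f G H \<longleftrightarrow> bij_betw f (verts G) (verts H) \<and>
     (\<forall>u\<in>verts G. \<forall>v\<in>verts G. (u \<rightarrow>\<^bsub>G\<^esub> v) \<longleftrightarrow> (f u \<rightarrow>\<^bsub>H\<^esub> f v))"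

text \<open>
  Automorphisms are the identity outside the vertex set, so that equality of automorphisms is
  equality of functions.
\<close>

definition Aut :: "('a, 'b) pre_digraph \<Rightarrow> ('a \<Rightarrow> 'a) set" where
  "Aut G = {g. g permutes verts G \<and> graph_isomorphism g G G}"

definition determining_set :: "('a, 'b) pre_digraph \<Rightarrow> 'a set \<Rightarrow> bool" where
  "determining_set G S \<longleftrightarrow> S \<subseteq> verts G \<and>
     (\<forall>g\<in>Aut G. \<forall>h\<in>Aut G. (\<forall>s\<in>S. g s = h s) \<longrightarrow> g = h)"

text \<open>
  The strongly connected components of a symmetric digraph are the connected components of the
  undirected graph.
\<close>

definition branches :: "('a, 'b) pre_digraph \<Rightarrow> 'a \<Rightarrow> ('a, 'b) pre_digraph set" where
  "branches G v =
     {G \<restriction> insert v C | C. C \<in> pre_digraph.sccs_verts (pre_digraph.del_vert G v)}"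

definition branch_iso ::
    "('a, 'b) pre_digraph \<Rightarrow> 'a \<Rightarrow> (('a, 'b) pre_digraph \<times> ('a, 'b) pre_digraph) set" where
  "branch_iso G v = {(H, K). H \<in> branches G v \<and> K \<in> branches G v \<and>
     (\<exists>f. graph_isomorphism f H K \<and> f v = v)}"

end

theory Submission
  imports Defs
begin

text \<open>
  If two isomorphic branches at \<open>v\<close> both avoid \<open>S - {v}\<close>, exchanging them along an isomorphism
  is a nontrivial automorphism fixing \<open>S\<close> pointwise. Conversely, let \<open>k\<close> be a nontrivial
  automorphism fixing \<open>S\<close> pointwise. It fixes the unique central vertex, so by connectedness there
  is an edge from a fixed vertex \<open>v\<close> to a moved vertex \<open>w\<close>. As there are no cycles, \<open>w\<close> and
  \<open>k w\<close> lie in different branches at \<open>v\<close>; \<open>k\<close> maps the first onto the second, so neither of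
  them contains a fixed point other than \<open>v\<close>.
\<close>

section \<open>Isomorphisms and subgraphs\<close>

lemma graph_isomorphism_id: "graph_isomorphism id G G"
  by (auto simp: graph_isomorphism_def)

lemma graph_isomorphism_comp:
  assumes "graph_isomorphism f G H" "graph_isomorphism g H K"
  shows "graph_isomorphism (g \<circ> f) G K"
  using assms by (auto simp: graph_isomorphism_def bij_betw_apply intro: bij_betw_trans)

lemma graph_isomorphism_inv_into:
  assumes "graph_isomorphism f G H"
  shows "graph_isomorphism (inv_into (verts G) f) H G"
proof -
  have f: "bij_betw f (verts G) (verts H)"
    using assms by (simp add: graph_isomorphism_def)
  show ?thesis
    unfolding graph_isomorphism_def
  proof (intro conjI ballI)
    show "bij_betw (inv_into (verts G) f) (verts H) (verts G)"
      by (rule bij_betw_inv_into[OF f])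
    fix u v assume "u \<in> verts H" "v \<in> verts H"
    then show "u \<rightarrow>\<^bsub>H\<^esub> v \<longleftrightarrow> inv_into (verts G) f u \<rightarrow>\<^bsub>G\<^esub> inv_into (verts G) f v"
      using assms bij_betw_apply[OF bij_betw_inv_into[OF f]] bij_betw_inv_into_right[OF f]
      by (auto simp: graph_isomorphism_def)
  qed
qed

lemma dominates_del_vert_iff:
  "u \<rightarrow>\<^bsub>pre_digraph.del_vert G v\<^esub> w \<longleftrightarrow> u \<rightarrow>\<^bsub>G\<^esub> w \<and> u \<noteq> v \<and> w \<noteq> v"
  by (auto simp: arcs_ends_def arc_to_ends_def pre_digraph.del_vert_simps)

lemma dominates_induce_subgraph_iff:
  "u \<rightarrow>\<^bsub>G \<restriction> S\<^esub> w \<longleftrightarrow> u \<rightarrow>\<^bsub>G\<^esub> w \<and> u \<in> S \<and> w \<in> S"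
  by (auto simp: arcs_ends_def arc_to_ends_def)

text \<open>Makes the strong components of \<open>del_vert v\<close> ordinary reachability
  classes.\<close>

lemma (in sym_digraph) sym_digraph_del_vert: "sym_digraph (del_vert v)"
proof -
  interpret D: wf_digraph "del_vert v" by (rule wf_digraph_del_vert)
  have "symmetric (del_vert v)"
    using sym_arcs by (auto simp: symmetric_def dominates_del_vert_iff intro!: symI dest: symD)
  then show ?thesis by unfold_locales
qed

section \<open>Invariance of distance, eccentricity and center\<close>

lemma graph_isomorphism_awalk:
  assumes f: "graph_isomorphism f G H" and G: "wf_digraph G" and H: "wf_digraph H"
    and "pre_digraph.awalk G u p v"
  shows "\<exists>q. pre_digraph.awalk H (f u) q (f v) \<and> length q = length p"
  using assms(4)
proof (induction p arbitrary: u)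
  case Nil
  then show ?case
    using f by (auto simp: wf_digraph.awalk_Nil_iff[OF G] wf_digraph.awalk_Nil_iff[OF H]
        graph_isomorphism_def bij_betw_apply)
next
  case (Cons e p)
  then have e: "e \<in> arcs G" "u = tail G e" and w: "pre_digraph.awalk G (head G e) p v"
    by (auto simp: wf_digraph.awalk_Cons_iff[OF G])
  obtain q where q: "pre_digraph.awalk H (f (head G e)) q (f v)" "length q = length p"
    using Cons.IH[OF w] by blast
  have "tail G e \<rightarrow>\<^bsub>G\<^esub> head G e"
    using e(1) by (auto simp: arcs_ends_def arc_to_ends_def)
  moreover have "tail G e \<in> verts G" "head G e \<in> verts G"
    using e(1) G by (auto simp: wf_digraph_def)
  ultimately have "f (tail G e) \<rightarrow>\<^bsub>H\<^esub> f (head G e)"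
    using f by (auto simp: graph_isomorphism_def)
  \<comment> \<open>The map \<open>f\<close> acts on vertices only, so an arc of \<open>H\<close>
    over the image edge has to be chosen.\<close>
  then obtain a where "a \<in> arcs H" "tail H a = f (tail G e)" "head H a = f (head G e)"
    by (auto simp: arcs_ends_def arc_to_ends_def)
  then have "pre_digraph.awalk H (f u) (a # q) (f v)"
    using q e by (simp add: wf_digraph.awalk_Cons_iff[OF H])
  then show ?case
    using q(2) by (metis length_Cons)
qed

lemma graph_isomorphism_reachable:
  assumes "graph_isomorphism f G H" "wf_digraph G" "wf_digraph H" "u \<rightarrow>\<^sup>*\<^bsub>G\<^esub> v"
  shows "f u \<rightarrow>\<^sup>*\<^bsub>H\<^esub> f v"
  using graph_isomorphism_awalk[OF assms(1-3)] assms(4)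
  unfolding wf_digraph.reachable_awalk[OF assms(2)] wf_digraph.reachable_awalk[OF assms(3)] by blast

lemma (in wf_digraph) graph_distance_conv_length:
  "graph_distance G u v = (INF p\<in>{p. awalk u p v}. ereal (real (length p)))"
proof -
  have "awalk_cost (\<lambda>_. 1) p = real (length p)" for p
    by (induction p) auto
  then show ?thesis
    by (simp add: graph_distance_def \<mu>_def)
qed

lemma graph_isomorphism_distance_le:
  assumes "graph_isomorphism f G H" "wf_digraph G" "wf_digraph H"
  shows "graph_distance H (f u) (f v) \<le> graph_distance G u v"
  unfolding wf_digraph.graph_distance_conv_length[OF assms(2)]
    wf_digraph.graph_distance_conv_length[OF assms(3)]
proof (rule INF_greatest)
  fix p assume "p \<in> {p. pre_digraph.awalk G u p v}"
  then obtain q where "pre_digraph.awalk H (f u) q (f v)" "length q = length p"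
    using graph_isomorphism_awalk[OF assms] by blast
  then show "(INF p\<in>{p. pre_digraph.awalk H (f u) p (f v)}. ereal (real (length p)))
      \<le> ereal (real (length p))"
    by (metis (mono_tags, lifting) INF_lower mem_Collect_eq)
qed

text \<open>Isomorphisms do not increase distances; applying this to \<open>f\<close> and to its
  inverse gives equality.\<close>

lemma graph_isomorphism_distance:
  assumes f: "graph_isomorphism f G H" and G: "wf_digraph G" and H: "wf_digraph H"
    and "u \<in> verts G" "v \<in> verts G"
  shows "graph_distance H (f u) (f v) = graph_distance G u v"
proof (rule antisym)
  have "inj_on f (verts G)"
    using f by (auto simp: graph_isomorphism_def bij_betw_def)
  then show "graph_distance G u v \<le> graph_distance H (f u) (f v)"
    using graph_isomorphism_distance_le[OF graph_isomorphism_inv_into[OF f] H G, of "f u" "f v"]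
      assms(4,5) by simp
qed (rule graph_isomorphism_distance_le[OF f G H])

lemma graph_isomorphism_eccentricity:
  assumes "graph_isomorphism f G H" "wf_digraph G" "wf_digraph H" "u \<in> verts G"
  shows "eccentricity H (f u) = eccentricity G u"
proof -
  have "verts H = f ` verts G"
    using assms(1) by (auto simp: graph_isomorphism_def bij_betw_def)
  then show ?thesis
    using graph_isomorphism_distance[OF assms]
    by (simp add: eccentricity_def image_image cong: image_cong)
qed

text \<open>Eccentricity is invariant under automorphisms. When the center is a single vertex, this
  makes it a fixed point.\<close>

lemma Aut_center:
  assumes "wf_digraph G" "g \<in> Aut G" "c \<in> center G"
  shows "g c \<in> center G"
  using assms graph_isomorphism_eccentricity[of g G G c]
  by (auto simp: center_def Aut_def permutes_in_image)

section \<open>The automorphism group and stabilizers of a vertex\<close>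

lemma id_Aut: "id \<in> Aut G"
  by (simp add: Aut_def permutes_id graph_isomorphism_id)

lemma Aut_comp: "g \<in> Aut G \<Longrightarrow> h \<in> Aut G \<Longrightarrow> h \<circ> g \<in> Aut G"
  by (auto simp: Aut_def intro: permutes_compose graph_isomorphism_comp)

lemma Aut_inv:
  assumes "g \<in> Aut G"
  shows "inv g \<in> Aut G"
proof -
  have g: "g permutes verts G" "graph_isomorphism g G G"
    using assms by (auto simp: Aut_def)
  have "graph_isomorphism (inv g) G G"
    using g permutes_in_image[OF permutes_inv[OF g(1)]] permutes_inverses(1)[OF g(1)]
    by (auto simp: graph_isomorphism_def permutes_imp_bij permutes_inv)
  then show ?thesis
    using g by (simp add: Aut_def permutes_inv)
qed

lemma Aut_del_vert:
  assumes "k \<in> Aut G" "k v = v"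
  shows "graph_isomorphism k (pre_digraph.del_vert G v) (pre_digraph.del_vert G v)"
proof -
  have k: "k permutes verts G" "graph_isomorphism k G G"
    using assms(1) by (auto simp: Aut_def)
  have inj: "k x = k y \<longleftrightarrow> x = y" for x y
    using permutes_inj[OF k(1)] by (simp add: inj_eq)
  have "k x = v \<longleftrightarrow> x = v" for x
    using inj[of x v] assms(2) by simp
  moreover have "bij_betw k (verts G - {v}) (verts G - {v})"
    using permutes_imp_bij[OF k(1)] assms(2) inj
    by (auto simp: bij_betw_def inj_on_def image_set_diff[OF permutes_inj[OF k(1)]])
  ultimately show ?thesis
    using k(2) by (auto simp: graph_isomorphism_def dominates_del_vert_iff pre_digraph.del_vert_simps)
qed

section \<open>Components after deleting a vertex, and exchanging two branches\<close>

context sym_digraph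
begin

lemma sccs_verts_del_vert_subset:
  assumes "C \<in> pre_digraph.sccs_verts (del_vert v)"
  shows "C \<subseteq> verts G - {v}"
  using wf_digraph.sccs_verts_subsets[OF wf_digraph_del_vert assms] by (simp add: verts_del_vert)

lemma sccs_verts_del_vert_iff:
  assumes "C \<in> pre_digraph.sccs_verts (del_vert v)" "x \<in> C"
  shows "y \<in> C \<longleftrightarrow> x \<rightarrow>\<^sup>*\<^bsub>del_vert v\<^esub> y"
proof -
  interpret D: sym_digraph "del_vert v" by (rule sym_digraph_del_vert)
  show ?thesis
    using assms D.symmetric_reachable' unfolding D.in_sccs_verts_conv_reachable by blast
qed

text \<open>An edge can leave a component of \<open>del_vert v\<close> only through
  \<open>v\<close>. This is what lets a map defined branch by branch preserve edges.\<close>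

lemma sccs_verts_del_vert_closed:
  assumes "C \<in> pre_digraph.sccs_verts (del_vert v)" "x \<in> C" "x \<rightarrow> y" "y \<noteq> v"
  shows "y \<in> C"
proof -
  interpret D: sym_digraph "del_vert v" by (rule sym_digraph_del_vert)
  have "x \<noteq> v"
    using assms(1,2) sccs_verts_del_vert_subset by blast
  then have "x \<rightarrow>\<^bsub>del_vert v\<^esub> y"
    using assms(3,4) by (simp add: dominates_del_vert_iff)
  then show ?thesis
    using sccs_verts_del_vert_iff[OF assms(1,2)] D.reachable_adjI by blast
qed

lemma dominates_sym: "x \<rightarrow> y \<Longrightarrow> y \<rightarrow> x"
  using sym_arcs by (auto simp: symmetric_def dest: symD)

text \<open>The automorphism is \<open>f\<close> on \<open>C\<close>, its inverse on
  \<open>D\<close> and the identity elsewhere. The pieces fit together because every edge leaving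
  \<open>C\<close> or \<open>D\<close> ends in \<open>v\<close>, which is fixed.\<close>

lemma swap_branches:
  assumes C: "C \<in> pre_digraph.sccs_verts (del_vert v)"
    and D: "D \<in> pre_digraph.sccs_verts (del_vert v)"
    and "C \<noteq> D"
    and f: "graph_isomorphism f (G \<restriction> insert v C) (G \<restriction> insert v D)" and fv: "f v = v"
  obtains g where "g \<in> Aut G" "g \<noteq> id" "\<And>x. x \<notin> C \<union> D \<Longrightarrow> g x = x"
proof -
  have sub: "C \<subseteq> verts G" "D \<subseteq> verts G" "v \<notin> C" "v \<notin> D"
    using sccs_verts_del_vert_subset[OF C] sccs_verts_del_vert_subset[OF D] by auto
  have disj: "C \<inter> D = {}"
    using wf_digraph.sccs_verts_disjoint[OF wf_digraph_del_vert C D \<open>C \<noteq> D\<close>] .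
  define f' where "f' = inv_into (insert v C) f"
  have bij: "bij_betw f (insert v C) (insert v D)"
    using f by (simp add: graph_isomorphism_def)
  have left: "f' (f x) = x" if "x \<in> C" for x
    using bij_betw_inv_into_left[OF bij] that by (simp add: f'_def)
  have right: "f (f' x) = x" if "x \<in> D" for x
    using bij_betw_inv_into_right[OF bij] that by (simp add: f'_def)
  have f'v: "f' v = v"
    using bij_betw_inv_into_left[OF bij, of v] fv by (simp add: f'_def)
  \<comment> \<open>The value \<open>v\<close> is excluded: \<open>f x = v\<close> would give
    \<open>x = f' v = v\<close>, but \<open>v\<close> is not in \<open>C\<close>.\<close>
  have f_in: "f x \<in> D" if "x \<in> C" for x
    using bij_betw_apply[OF bij, of x] that left[OF that] f'v sub by auto
  have f'_in: "f' x \<in> C" if "x \<in> D" for x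
    using bij_betw_apply[OF bij_betw_inv_into[OF bij], of x] that right[OF that] fv sub
    by (auto simp: f'_def)
  define g where "g x = (if x \<in> C then f x else if x \<in> D then f' x else x)" for x
  \<comment> \<open>Including \<open>v\<close> here covers the edges between \<open>v\<close> and
    the component.\<close>
  have gC: "g x = f x" if "x \<in> insert v C" for x
    using that sub fv by (auto simp: g_def)
  have gD: "g x = f' x" if "x \<in> insert v D" for x
    using that sub f'v disj by (auto simp: g_def)
  have g_id: "g x = x" if "x \<notin> C \<union> D" for x
    using that by (simp add: g_def)
  have invol: "g (g x) = x" for x
    using disj f_in f'_in left right by (auto simp: g_def)
  have perm: "g permutes verts G"
    unfolding permutes_def using sub g_id invol by (metis Un_iff subsetD)
  have edge: "g x \<rightarrow> g y" if xy: "x \<rightarrow> y" for x y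
  proof -
    have CD: "x \<in> C \<Longrightarrow> y \<in> insert v C" "x \<in> D \<Longrightarrow> y \<in> insert v D"
      "y \<in> C \<Longrightarrow> x \<in> insert v C" "y \<in> D \<Longrightarrow> x \<in> insert v D"
      using sccs_verts_del_vert_closed[OF C] sccs_verts_del_vert_closed[OF D] xy dominates_sym[OF xy]
      by blast+
    then consider "x \<in> insert v C" "y \<in> insert v C" | "x \<in> insert v D" "y \<in> insert v D"
      | "x \<notin> C \<union> D" "y \<notin> C \<union> D"
      by blast
    then show ?thesis
    proof cases
      case 1
      then show ?thesis
        using f xy gC by (auto simp: graph_isomorphism_def dominates_induce_subgraph_iff)
    next
      case 2
      then show ?thesis
        using graph_isomorphism_inv_into[OF f] xy gD
        by (auto simp: graph_isomorphism_def dominates_induce_subgraph_iff f'_def)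
    next
      case 3
      then show ?thesis using xy g_id by simp
    qed
  qed
  \<comment> \<open>\<open>edge\<close> gives only one direction; the converse is
    \<open>edge\<close> applied to \<open>g x\<close> and \<open>g y\<close>, since \<open>g\<close>
    is an involution.\<close>
  have "graph_isomorphism g G G"
    unfolding graph_isomorphism_def using edge invol permutes_imp_bij[OF perm] by metis
  then have "g \<in> Aut G"
    using perm by (simp add: Aut_def)
  moreover have "C \<noteq> {}"
    using C by (auto simp: pre_digraph.sccs_verts_def)
  then have "g \<noteq> id"
    using f_in gC disj by (metis disjoint_iff ex_in_conv id_apply insertCI)
  ultimately show thesis
    using that g_id by blast
qed

lemma determining_set_imp_branches_meet:
  assumes det: "determining_set G S" and Q: "\<C> \<in> branches G v // branch_iso G v"
  shows "\<exists>B\<^sub>0\<in>\<C>. \<forall>B\<in>\<C> - {B\<^sub>0}. verts B \<inter> (S - {v}) \<noteq> {}"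
proof (rule ccontr)
  assume contr: "\<not> ?thesis"
  obtain X where X: "X \<in> branches G v" "\<C> = branch_iso G v `` {X}"
    using Q by (auto elim: quotientE)
  have "X \<in> \<C>"
    using X graph_isomorphism_id by (fastforce simp: branch_iso_def)
  \<comment> \<open>The failed condition is used twice: with \<open>X\<close> as the exception it
    yields \<open>H\<close>, with \<open>H\<close> as the exception it yields
    \<open>K\<close>.\<close>
  then obtain H where H: "H \<in> \<C>" "verts H \<inter> (S - {v}) = {}"
    using contr by blast
  then obtain K where K: "K \<in> \<C>" "K \<noteq> H" "verts K \<inter> (S - {v}) = {}"
    using contr by blast
  obtain C where C: "C \<in> pre_digraph.sccs_verts (del_vert v)" "H = G \<restriction> insert v C"
    using H(1) X(2) by (auto simp: branch_iso_def branches_def)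
  obtain D where D: "D \<in> pre_digraph.sccs_verts (del_vert v)" "K = G \<restriction> insert v D"
    using K(1) X(2) by (auto simp: branch_iso_def branches_def)
  obtain f where f: "graph_isomorphism f X H" "f v = v"
    using H(1) X(2) by (auto simp: branch_iso_def)
  obtain h where h: "graph_isomorphism h X K" "h v = v"
    using K(1) X(2) by (auto simp: branch_iso_def)
  have "v \<in> verts X"
    using X(1) by (auto simp: branches_def)
  moreover have "inj_on f (verts X)"
    using f(1) by (auto simp: graph_isomorphism_def bij_betw_def)
  ultimately have "inv_into (verts X) f v = v"
    using f(2) by (metis inv_into_f_f)
  \<comment> \<open>\<open>H\<close> and \<open>K\<close> are related only through the
    representative \<open>X\<close>, so the isomorphism between them is composed via
    \<open>X\<close>.\<close>
  then have "(h \<circ> inv_into (verts X) f) v = v"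
    using h(2) by simp
  then obtain g where g: "g \<in> Aut G" "g \<noteq> id" "\<And>x. x \<notin> C \<union> D \<Longrightarrow> g x = x"
    using swap_branches[OF C(1) D(1)] K(2) C(2) D(2)
      graph_isomorphism_comp[OF graph_isomorphism_inv_into[OF f(1)] h(1)]
    by metis
  \<comment> \<open>Even if \<open>v\<close> is in \<open>S\<close>, it lies in neither
    \<open>C\<close> nor \<open>D\<close>, so removing it from \<open>S\<close> loses nothing
    here.\<close>
  have "S \<inter> (C \<union> D) = {}"
    using H(2) K(3) C D sccs_verts_del_vert_subset[OF C(1)] sccs_verts_del_vert_subset[OF D(1)] by auto
  then have "\<forall>s\<in>S. g s = id s"
    using g(3) by auto
  then show False
    using det g(1,2) id_Aut unfolding determining_set_def by blast
qed

end

section \<open>Automorphisms fixing a vertex of an acyclic graph\<close>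

lemma (in graph) two_neighbours_connected_imp_cycle:
  assumes "v \<rightarrow> w" "v \<rightarrow> w'" "w \<noteq> w'" "w \<rightarrow>\<^sup>*\<^bsub>del_vert v\<^esub> w'"
  shows "\<exists>p. cycle p \<and> 3 \<le> length p"
proof -
  interpret D: wf_digraph "del_vert v" by (rule wf_digraph_del_vert)
  \<comment> \<open>A path avoiding \<open>v\<close> is closed up by the edges from \<open>v\<close>
    to \<open>w\<close> and from \<open>w'\<close> to \<open>v\<close>.\<close>
  obtain p where p: "D.apath w p w'"
    using assms(4) D.reachable_apath by blast
  have p': "apath w p w'"
    using subgraph_apath_imp_apath[OF p subgraph_del_vert] .
  have v: "v \<notin> set (awalk_verts w p)"
  proof -
    have "set (D.awalk_verts w p) \<subseteq> verts G - {v}"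
      using D.awalkE[OF D.awalkI_apath[OF p]] by (simp add: verts_del_vert)
    moreover have "D.awalk_verts w p = awalk_verts w p"
      by (simp add: D.awalk_verts_conv awalk_verts_conv tail_del_vert head_del_vert)
    ultimately show ?thesis by auto
  qed
  obtain a where a: "a \<in> arcs G" "tail G a = v" "head G a = w"
    using assms(1) by (auto simp: arcs_ends_def arc_to_ends_def)
  obtain b where b: "b \<in> arcs G" "tail G b = w'" "head G b = v"
    using dominates_sym[OF assms(2)] by (auto simp: arcs_ends_def arc_to_ends_def)
  have "p \<noteq> []"
    using p' assms(3) by (auto simp: apath_Nil_iff)
  have wp: "awalk w p w'"
    using p' by (simp add: apath_def)
  have wb: "awalk w (p @ [b]) v"
    using wp b by (auto intro!: awalk_appendI[of w p w'] simp: awalk_Cons_iff awalk_Nil_iff)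
  then have wk: "awalk v (a # p @ [b]) v"
    using a awalk_Cons_iff[of v a "p @ [b]" v] by blast
  have "awalk_verts w (p @ [b]) = awalk_verts w p @ [v]"
    using awalk_verts_append[OF wb] b by simp
  \<comment> \<open>Dropping the first occurrence of \<open>v\<close> leaves the vertices of the
    path followed by \<open>v\<close>, which is not among them.\<close>
  then have "distinct (tl (awalk_verts v (a # p @ [b])))"
    using a v p' by (simp add: apath_def)
  then have "cycle (a # p @ [b])"
    using wk by (auto simp: cycle_def)
  moreover have "3 \<le> length (a # p @ [b])"
    using \<open>p \<noteq> []\<close> by (cases p) auto
  ultimately show ?thesis by blast
qed

text \<open>As \<open>k\<close> fixes \<open>v\<close>, it restricts to an automorphism of
  \<open>del_vert v\<close> and permutes the components; the image of the one vertex
  \<open>w\<close> decides which component \<open>C\<close> is mapped onto.\<close>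

lemma (in graph) Aut_branch_image:
  assumes k: "k \<in> Aut G" "k v = v"
    and C: "C \<in> pre_digraph.sccs_verts (del_vert v)"
    and D: "D \<in> pre_digraph.sccs_verts (del_vert v)"
    and w: "w \<in> C" "k w \<in> D"
  shows "k ` C = D" and "graph_isomorphism k (G \<restriction> insert v C) (G \<restriction> insert v D)"
proof -
  have perm: "k permutes verts G" and iso: "graph_isomorphism k G G"
    using k(1) by (auto simp: Aut_def)
  have inv_k: "inv k \<in> Aut G" "inv k v = v"
    using Aut_inv[OF k(1)] permutes_inv_eq[OF perm] k(2) by auto
  note reach = graph_isomorphism_reachable[OF Aut_del_vert wf_digraph_del_vert wf_digraph_del_vert]
  show im: "k ` C = D"
  proof
    show "k ` C \<subseteq> D"
      using reach[OF k] sccs_verts_del_vert_iff[OF C w(1)] sccs_verts_del_vert_iff[OF D w(2)] by blast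
    \<comment> \<open>Reachability from \<open>k w\<close> to \<open>y\<close> is carried back by
      \<open>inv k\<close>, which also fixes \<open>v\<close>.\<close>
    show "D \<subseteq> k ` C"
    proof
      fix y assume "y \<in> D"
      then have "inv k y \<in> C"
        using reach[OF inv_k, of "k w" y] sccs_verts_del_vert_iff[OF C w(1)]
          sccs_verts_del_vert_iff[OF D w(2)] permutes_inverses(2)[OF perm] by simp
      then show "y \<in> k ` C"
        using permutes_inverses(1)[OF perm, of y] by force
    qed
  qed
  have "k ` insert v C = insert v D"
    unfolding image_insert im k(2) ..
  then have "bij_betw k (insert v C) (insert v D)"
    using inj_on_subset[OF permutes_inj[OF perm] subset_UNIV] unfolding bij_betw_def by blast
  moreover have "x \<rightarrow> y \<longleftrightarrow> k x \<rightarrow> k y" for x y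
    using iso perm adj_in_verts permutes_in_image[OF perm] unfolding graph_isomorphism_def by metis
  ultimately show "graph_isomorphism k (G \<restriction> insert v C) (G \<restriction> insert v D)"
    using bij_betw_apply[of k "insert v C" "insert v D"]
    unfolding graph_isomorphism_def dominates_induce_subgraph_iff induce_subgraph_verts by blast
qed

text \<open>Being fixed by \<open>k\<close> spreads from a vertex to its neighbours
  (\<open>step\<close>), hence from \<open>c\<close> to every vertex.\<close>

lemma (in graph) branches_meet_imp_fixing_Aut_trivial:
  assumes acyclic: "\<not> (\<exists>p. cycle p \<and> 3 \<le> length p)"
    and reach: "\<And>x. x \<in> verts G \<Longrightarrow> c \<rightarrow>\<^sup>* x"
    and meet: "\<And>v \<C>. v \<in> verts G \<Longrightarrow> \<C> \<in> branches G v // branch_iso G v \<Longrightarrow>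
       \<exists>B\<^sub>0\<in>\<C>. \<forall>B\<in>\<C> - {B\<^sub>0}. verts B \<inter> (S - {v}) \<noteq> {}"
    and k: "k \<in> Aut G" "k c = c" "\<And>s. s \<in> S \<Longrightarrow> k s = s"
  shows "k = id"
proof -
  have perm: "k permutes verts G" and iso: "graph_isomorphism k G G"
    using k(1) by (auto simp: Aut_def)
  have step: "k w = w" if vw: "v \<rightarrow> w" and kv: "k v = v" for v w
  proof (rule ccontr)
    assume neq: "k w \<noteq> w"
    interpret D: sym_digraph "del_vert v" by (rule sym_digraph_del_vert)
    have "v \<rightarrow> k w"
      using vw kv iso adj_in_verts[OF vw] unfolding graph_isomorphism_def by metis
    then have ends: "w \<in> verts (del_vert v)" "k w \<in> verts (del_vert v)"
      using adj_in_verts vw adj_not_same by (auto simp: verts_del_vert)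
    define C where "C = D.scc_of w"
    define D where "D = D.scc_of (k w)"
    have C: "C \<in> D.sccs_verts" "w \<in> C" and D: "D \<in> D.sccs_verts" "k w \<in> D"
      using ends by (auto simp: C_def D_def D.scc_of_in_sccs_verts D.in_scc_of_self)
    \<comment> \<open>Two distinct neighbours of \<open>v\<close> joined in
      \<open>del_vert v\<close> would give a cycle.\<close>
    have "\<not> w \<rightarrow>\<^sup>*\<^bsub>del_vert v\<^esub> k w"
      using two_neighbours_connected_imp_cycle[OF vw \<open>v \<rightarrow> k w\<close>] neq acyclic by auto
    then have "k w \<notin> C"
      using sccs_verts_del_vert_iff[OF C] by simp
    then have disj: "C \<inter> D = {}"
      using D.sccs_verts_disjoint[OF C(1) D(1)] D(2) by blast
    define H where "H = G \<restriction> insert v C"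
    define K where "K = G \<restriction> insert v D"
    note image = Aut_branch_image[OF k(1) kv C(1) D(1) C(2) D(2)]
    have HK: "H \<in> branches G v" "K \<in> branches G v"
      using C D by (auto simp: branches_def H_def K_def)
    have "v \<notin> C" "v \<notin> D"
      using sccs_verts_del_vert_subset[OF C(1)] sccs_verts_del_vert_subset[OF D(1)] by auto
    then have "H \<noteq> K"
      using disj C(2) by (metis H_def K_def disjoint_iff induce_subgraph_verts insert_ident)
    have "H \<in> branch_iso G v `` {H}" "K \<in> branch_iso G v `` {H}"
      using HK graph_isomorphism_id[of H] image(2) kv
      by (fastforce simp: branch_iso_def H_def K_def)+
    \<comment> \<open>\<open>H\<close> and \<open>K\<close> are distinct members of one class, so at
      most one of them is the exception.\<close>
    then have "verts H \<inter> (S - {v}) \<noteq> {} \<or> verts K \<inter> (S - {v}) \<noteq> {}"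
      using meet[of v "branch_iso G v `` {H}"] quotientI[OF HK(1)] adj_in_verts[OF vw] \<open>H \<noteq> K\<close>
      by blast
    then obtain s where "s \<in> S" "s \<in> C \<or> s \<in> D"
      by (auto simp: H_def K_def)
    \<comment> \<open>\<open>k\<close> maps \<open>C\<close> bijectively onto \<open>D\<close> and
      fixes \<open>s\<close>, so \<open>s\<close> lies in one exactly when it lies in the
      other.\<close>
    then have "s \<in> C \<inter> D"
      using k(3) image(1) permutes_inj[OF perm] by (metis IntI image_eqI image_iff inj_eq)
    then show False using disj by blast
  qed
  have "k x = x" if "c \<rightarrow>\<^sup>* x" for x
    using that by (induction rule: reachable_induct) (auto simp: k(2) step)
  then show ?thesis
    using reach perm by (metis id_apply permutes_not_in ext)
qed

theorem theorem11:
  fixes T :: "('a, 'b) pre_digraph" and S :: "'a set"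
  assumes "undirected_tree T"
    and "\<exists>c. center T = {c}"
    and "S \<subseteq> verts T"
  shows "determining_set T S \<longleftrightarrow>
    (\<forall>v\<in>verts T. \<forall>\<C>\<in>branches T v // branch_iso T v.
       \<exists>B\<^sub>0\<in>\<C>. \<forall>B\<in>\<C> - {B\<^sub>0}. verts B \<inter> (S - {v}) \<noteq> {})"
proof
  interpret graph T
    using assms(1) by (simp add: undirected_tree_def)
  show "\<forall>v\<in>verts T. \<forall>\<C>\<in>branches T v // branch_iso T v.
       \<exists>B\<^sub>0\<in>\<C>. \<forall>B\<in>\<C> - {B\<^sub>0}. verts B \<inter> (S - {v}) \<noteq> {}" if "determining_set T S"
    using determining_set_imp_branches_meet[OF that] by blast
  assume meet: "\<forall>v\<in>verts T. \<forall>\<C>\<in>branches T v // branch_iso T v.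
       \<exists>B\<^sub>0\<in>\<C>. \<forall>B\<in>\<C> - {B\<^sub>0}. verts B \<inter> (S - {v}) \<noteq> {}"
  obtain c where c: "center T = {c}"
    using assms(2) by blast
  have "strongly_connected T"
    using assms(1) symmetric_connected_imp_strongly_connected[OF sym_arcs]
    by (simp add: undirected_tree_def)
  moreover have "c \<in> verts T"
    using c by (auto simp: center_def)
  ultimately have reach: "c \<rightarrow>\<^sup>*\<^bsub>T\<^esub> x" if "x \<in> verts T" for x
    using that by (auto simp: strongly_connected_def)
  have "g = h" if g: "g \<in> Aut T" and h: "h \<in> Aut T" and eq: "\<forall>s\<in>S. g s = h s" for g h
  proof -
    have perm: "h permutes verts T"
      using h by (simp add: Aut_def)
    \<comment> \<open>Agreement of \<open>g\<close> and \<open>h\<close> on \<open>S\<close> says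
      that this quotient fixes \<open>S\<close> pointwise.\<close>
    have k: "inv h \<circ> g \<in> Aut T"
      by (rule Aut_comp[OF g Aut_inv[OF h]])
    have "inv h \<circ> g = id"
    proof (rule branches_meet_imp_fixing_Aut_trivial[OF _ reach meet[rule_format] k])
      show "\<not> (\<exists>p. cycle p \<and> 3 \<le> length p)"
        using assms(1) by (simp add: undirected_tree_def)
      \<comment> \<open>The center is mapped into itself and has \<open>c\<close> as its only
        element.\<close>
      show "(inv h \<circ> g) c = c"
        using Aut_center[OF wf_digraph k, of c] c by simp
      show "(inv h \<circ> g) s = s" if "s \<in> S" for s
        using that eq permutes_inverses(2)[OF perm] by simp
    qed
    then have "h \<circ> (inv h \<circ> g) = h"
      by simp
    then show ?thesis
      using permutes_inv_o(1)[OF perm] by (simp add: o_assoc)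
  qed
  then show "determining_set T S"
    using assms(3) by (auto simp: determining_set_def)
qed

end
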